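(* Let $s\ge 2$, $k \ge 0$ be two integers. Every locally $s$-colourable graph $G$ satisfies $f_G(\chi (G) + k) \le (s-1)(k+1) + 1$.
   Context: All graphs are finite, simple and non-empty. A graph $G$ is locally $s$-colourable if for every vertex $v$ the subgraph induced by the closed neighbourhood $N[v]$ has chromatic number at most $s$. For $\chi(G)\le p\le |V(G)|$, let $\mathscr{C}_p(G)$ be the set of proper colourings of $G$ using exactly $p$ colours, and define $f_G(p)=\max_{\sigma\in\mathscr{C}_p(G)}\min\{\chi(G[X]) : X\subseteq V(G),\ |\sigma(X)|=p\}$. *)

theory Defs
  imports "Graph_Theory.Digraph_Component" "HOL-Library.FuncSet"
begin

text \<open>
  A finite simple graph is a \<open>graph\<close> in the sense of the Graph_Theory entry: a finite digraph
  without loops and parallel arcs whose adjacency relation \<open>u \<rightarrow>\<^bsub>G\<^esub> v\<close> is symmetric.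
  The induced subgraph \<open>G[X]\<close> is \<open>G \<restriction> X\<close>.
\<close>

definition proper_colouring :: "('a, 'b) pre_digraph \<Rightarrow> ('a \<Rightarrow> nat) \<Rightarrow> bool" where
  "proper_colouring G \<sigma> \<longleftrightarrow> (\<forall>u\<in>verts G. \<forall>v\<in>verts G. u \<rightarrow>\<^bsub>G\<^esub> v \<longrightarrow> \<sigma> u \<noteq> \<sigma> v)"

definition colourable :: "('a, 'b) pre_digraph \<Rightarrow> nat \<Rightarrow> bool" where
  "colourable G n \<longleftrightarrow> (\<exists>\<sigma> \<in> verts G \<rightarrow> {..<n}. proper_colouring G \<sigma>)"

definition chromatic_number :: "('a, 'b) pre_digraph \<Rightarrow> nat" where
  "chromatic_number G = (LEAST n. colourable G n)"

definition closed_neighbourhood :: "('a, 'b) pre_digraph \<Rightarrow> 'a \<Rightarrow> 'a set" where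
  "closed_neighbourhood G v = insert v {u \<in> verts G. v \<rightarrow>\<^bsub>G\<^esub> u}"

definition locally_colourable :: "nat \<Rightarrow> ('a, 'b) pre_digraph \<Rightarrow> bool" where
  "locally_colourable s G \<longleftrightarrow>
     (\<forall>v\<in>verts G. chromatic_number (G \<restriction> closed_neighbourhood G v) \<le> s)"

text \<open>
  The colours are \<open>0, \<dots>, p - 1\<close>, and all of them occur.  Colourings are extensional
  (undefined outside the vertex set), so each colouring of \<open>G\<close> is counted once and the set
  is finite.
\<close>

definition exact_colourings :: "('a, 'b) pre_digraph \<Rightarrow> nat \<Rightarrow> ('a \<Rightarrow> nat) set" where
  "exact_colourings G p =
     {\<sigma> \<in> verts G \<rightarrow>\<^sub>E {..<p}. proper_colouring G \<sigma> \<and> \<sigma> ` verts G = {..<p}}"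

text \<open>
  Meaningful for \<open>chromatic_number G \<le> p \<le> card (verts G)\<close> only: otherwise there are no
  colourings with exactly \<open>p\<close> colours and the maximum is over the empty set.
\<close>

definition f_col :: "('a, 'b) pre_digraph \<Rightarrow> nat \<Rightarrow> nat" where
  "f_col G p =
     Max ((\<lambda>\<sigma>. Min ((\<lambda>X. chromatic_number (G \<restriction> X)) ` {X. X \<subseteq> verts G \<and> card (\<sigma> ` X) = p}))
          ` exact_colourings G p)"

end

theory Submission
  imports Defs
begin

text \<open>
  Fix a proper colouring \<open>\<sigma>\<close> of \<open>G\<close> with \<open>p\<close> colours.  At most \<open>p - \<chi>(G) + 1\<close> closed neighbourhoods
  suffice to see all colours, by induction on \<open>p\<close>: choose a vertex \<open>w\<close> whose closed neighbourhood sees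
  the most colours, and a colour \<open>c\<close> that it does not see.  By maximality no vertex of colour \<open>c\<close> sees
  all the colours seen by \<open>w\<close>, so the class \<open>c\<close> can be dissolved using only colours seen by \<open>w\<close>.  A
  family of neighbourhoods for the new colouring becomes one for \<open>\<sigma>\<close> after adding one vertex:
  \<open>w\<close>, or a vertex of colour \<open>c\<close> if that colour is not seen yet.

  If every closed neighbourhood is \<open>s\<close>-colourable, every open one is \<open>(s - 1)\<close>-colourable.  The vertices
  of a union of closed neighbourhoods \<open>N[w]\<close>, \<open>w \<in> W\<close>, that lie in no open \<open>N(w)\<close> form an
  independent subset of \<open>W\<close>, so the union needs at most \<open>(s - 1) |W| + 1\<close> colours.
\<close>

lemma adj_induce_subgraph_iff:
  "u \<rightarrow>\<^bsub>G \<restriction> X\<^esub> v \<longleftrightarrow> u \<in> X \<and> v \<in> X \<and> u \<rightarrow>\<^bsub>G\<^esub> v"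
  by (auto simp: arcs_ends_def arc_to_ends_def induce_subgraph_def)

text \<open>A bijection onto an initial segment of the naturals relabels the colours, so they may
  have any type; tagged pairs serve as colours later on.\<close>

lemma chromatic_number_le_card_image:
  fixes f :: "'a \<Rightarrow> 'c"
  assumes fin: "finite (f ` verts G)"
    and proper: "\<And>u v. u \<in> verts G \<Longrightarrow> v \<in> verts G \<Longrightarrow> u \<rightarrow>\<^bsub>G\<^esub> v \<Longrightarrow> f u \<noteq> f v"
  shows "chromatic_number G \<le> card (f ` verts G)"
proof -
  obtain h where h: "bij_betw h (f ` verts G) {..<card (f ` verts G)}"
    using ex_bij_betw_finite_nat[OF fin] by (auto simp: atLeast0LessThan)
  have "colourable G (card (f ` verts G))"
    unfolding colourable_def proper_colouring_def
  proof (intro bexI ballI impI)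
    show "h \<circ> f \<in> verts G \<rightarrow> {..<card (f ` verts G)}"
      using bij_betwE[OF h] by auto
    show "(h \<circ> f) u \<noteq> (h \<circ> f) v" if "u \<in> verts G" "v \<in> verts G" "u \<rightarrow>\<^bsub>G\<^esub> v" for u v
      using proper[OF that] that inj_on_eq_iff[OF bij_betw_imp_inj_on[OF h]] by auto
  qed
  then show ?thesis
    unfolding chromatic_number_def by (rule Least_le)
qed

text \<open>A \<open>LEAST\<close> is attained once some number has the property; without loops, an
  injective colouring provides one.\<close>

lemma colourable_chromatic_number:
  assumes fin: "finite (verts G)" and loopfree: "\<And>v. \<not> v \<rightarrow>\<^bsub>G\<^esub> v"
  shows "colourable G (chromatic_number G)"
proof -
  obtain h where h: "bij_betw h (verts G) {..<card (verts G)}"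
    using ex_bij_betw_finite_nat[OF fin] by (auto simp: atLeast0LessThan)
  have "colourable G (card (verts G))"
    unfolding colourable_def proper_colouring_def
  proof (intro bexI ballI impI)
    show "h \<in> verts G \<rightarrow> {..<card (verts G)}"
      using bij_betwE[OF h] by auto
    show "h u \<noteq> h v" if "u \<in> verts G" "v \<in> verts G" "u \<rightarrow>\<^bsub>G\<^esub> v" for u v
      using loopfree that inj_on_eq_iff[OF bij_betw_imp_inj_on[OF h]] by metis
  qed
  then show ?thesis
    unfolding chromatic_number_def by (rule LeastI)
qed

context graph
begin

lemma not_adj_self: "\<not> v \<rightarrow>\<^bsub>G\<^esub> v"
  using adj_not_same by blast

lemma adj_sym: "u \<rightarrow>\<^bsub>G\<^esub> v \<Longrightarrow> v \<rightarrow>\<^bsub>G\<^esub> u"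
  using sym_arcs by (auto simp: symmetric_def dest: symD)

lemma closed_neighbourhood_subset:
  "v \<in> verts G \<Longrightarrow> closed_neighbourhood G v \<subseteq> verts G"
  by (auto simp: closed_neighbourhood_def)

text \<open>Starting from an optimal colouring, classes are split one at a time: while two vertices
  share a colour, one of them can receive a fresh one.\<close>

lemma ex_colouring_card:
  assumes "chromatic_number G + k \<le> card (verts G)"
  shows "\<exists>\<sigma>. proper_colouring G \<sigma> \<and> card (\<sigma> ` verts G) = chromatic_number G + k"
  using assms
proof (induction k)
  case 0
  obtain \<sigma> where \<sigma>: "\<sigma> \<in> verts G \<rightarrow> {..<chromatic_number G}" "proper_colouring G \<sigma>"
    using colourable_chromatic_number[OF finite_verts not_adj_self]
    by (auto simp: colourable_def)
  have "card (\<sigma> ` verts G) \<le> chromatic_number G"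
    using \<sigma>(1) card_mono[of "{..<chromatic_number G}" "\<sigma> ` verts G"] by auto
  moreover have "chromatic_number G \<le> card (\<sigma> ` verts G)"
    using \<sigma>(2) by (intro chromatic_number_le_card_image) (auto simp: proper_colouring_def)
  ultimately show ?case using \<sigma>(2) by auto
next
  case (Suc k)
  then obtain \<sigma> where \<sigma>: "proper_colouring G \<sigma>" "card (\<sigma> ` verts G) = chromatic_number G + k"
    by auto
  have "\<not> inj_on \<sigma> (verts G)"
    using \<sigma>(2) Suc.prems card_image[of \<sigma> "verts G"] by auto
  then obtain x y where xy: "x \<in> verts G" "y \<in> verts G" "x \<noteq> y" "\<sigma> x = \<sigma> y"
    by (auto simp: inj_on_def)
  obtain c where c: "c \<notin> \<sigma> ` verts G"
    using ex_new_if_finite[OF infinite_UNIV_nat] finite_verts by blast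
  \<comment> \<open>The old colour of \<open>x\<close> still occurs at \<open>y\<close>, so no
    colour is lost.\<close>
  have "(\<sigma>(x := c)) ` verts G = insert c (\<sigma> ` verts G)"
    using xy by (auto simp: image_iff)
  then have "card ((\<sigma>(x := c)) ` verts G) = chromatic_number G + Suc k"
    using c \<sigma>(2) by simp
  moreover have "proper_colouring G (\<sigma>(x := c))"
    using \<sigma>(1) c not_adj_self by (auto simp: proper_colouring_def)
  ultimately show ?case by blast
qed

text \<open>Guarantees that the \<open>Max\<close> in \<open>f_col\<close> is over a non-empty set.
  The colours are renamed to an initial segment, and \<open>restrict\<close> makes the colouring
  extensional.\<close>

lemma exact_colourings_nonempty:
  assumes "chromatic_number G + k \<le> card (verts G)"
  shows "exact_colourings G (chromatic_number G + k) \<noteq> {}"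
proof -
  let ?p = "chromatic_number G + k"
  obtain \<sigma> where \<sigma>: "proper_colouring G \<sigma>" "card (\<sigma> ` verts G) = ?p"
    using ex_colouring_card[OF assms] by blast
  obtain h where h: "bij_betw h (\<sigma> ` verts G) {..<?p}"
    using ex_bij_betw_finite_nat[of "\<sigma> ` verts G"] \<sigma>(2) by (auto simp: atLeast0LessThan)
  define \<tau> where "\<tau> = restrict (h \<circ> \<sigma>) (verts G)"
  have img: "\<tau> ` verts G = {..<?p}"
    using bij_betw_imp_surj_on[OF h] by (auto simp: \<tau>_def image_comp)
  have "\<tau> \<in> verts G \<rightarrow>\<^sub>E {..<?p}"
    using img by (auto simp: PiE_iff \<tau>_def)
  moreover have "proper_colouring G \<tau>"
    using \<sigma>(1) inj_on_eq_iff[OF bij_betw_imp_inj_on[OF h]]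
    by (auto simp: proper_colouring_def \<tau>_def)
  ultimately show ?thesis
    using img by (auto simp: exact_colourings_def)
qed

text \<open>Counting the colours in the image, instead of fixing a palette, lets the induction drop
  any colour \<open>c\<close> without renaming. The additive bound avoids truncated
  subtraction.\<close>

lemma ex_neighbourhoods_see_all_colours:
  assumes "proper_colouring G \<sigma>" and "verts G \<noteq> {}"
  shows "\<exists>W\<subseteq>verts G. card W + chromatic_number G \<le> card (\<sigma> ` verts G) + 1 \<and>
    \<sigma> ` (\<Union>w\<in>W. closed_neighbourhood G w) = \<sigma> ` verts G"
  using assms(1)
proof (induction "card (\<sigma> ` verts G)" arbitrary: \<sigma> rule: less_induct)
  case less
  let ?C = "\<sigma> ` verts G"
  let ?S = "\<lambda>v. \<sigma> ` closed_neighbourhood G v"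
  have S_sub: "?S v \<subseteq> ?C" if "v \<in> verts G" for v
    using closed_neighbourhood_subset[OF that] by (rule image_mono)
  have chi: "chromatic_number G \<le> card ?C"
    using less.prems by (intro chromatic_number_le_card_image) (auto simp: proper_colouring_def)
  have finS: "finite (?S ` verts G)" by simp
  obtain w where w: "w \<in> verts G" and wmax: "\<And>v. v \<in> verts G \<Longrightarrow> \<not> ?S w \<subset> ?S v"
    using finite_has_maximal[OF finS] assms(2) by (auto simp: less_le) blast
  show ?case
  proof (cases "?S w = ?C")
    case True
    then show ?thesis
      using w chi by (intro exI[of _ "{w}"]) auto
  next
    case False
    then obtain c where c: "c \<in> ?C" "c \<notin> ?S w"
      using S_sub[OF w] by blast
    \<comment> \<open>Otherwise \<open>?S v\<close> would contain \<open>?S w\<close>, and strictly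
      so because of \<open>c\<close>, against the inclusion-maximality of
      \<open>?S w\<close>.\<close>
    have "\<exists>d. d \<in> ?S w \<and> d \<notin> ?S v" if "v \<in> verts G" "\<sigma> v = c" for v
    proof -
      have "c \<in> ?S v" using that by (auto simp: closed_neighbourhood_def)
      then show ?thesis using wmax[OF that(1)] c(2) by blast
    qed
    then obtain r where r: "\<And>v. v \<in> verts G \<Longrightarrow> \<sigma> v = c \<Longrightarrow> r v \<in> ?S w \<and> r v \<notin> ?S v"
      by metis
    define \<tau> where "\<tau> v = (if \<sigma> v = c then r v else \<sigma> v)" for v
    have img: "\<tau> ` verts G = ?C - {c}"
    proof
      show "\<tau> ` verts G \<subseteq> ?C - {c}"
      proof
        fix d assume "d \<in> \<tau> ` verts G"
        then obtain v where v: "v \<in> verts G" "d = \<tau> v" by blast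
        show "d \<in> ?C - {c}"
        proof (cases "\<sigma> v = c")
          case True
          then have "d \<in> ?S w" using r[OF v(1)] v(2) by (simp add: \<tau>_def)
          then show ?thesis using c(2) S_sub[OF w] by blast
        next
          case False
          then show ?thesis using v by (simp add: \<tau>_def)
        qed
      qed
      show "?C - {c} \<subseteq> \<tau> ` verts G"
        by (auto simp: \<tau>_def image_iff)
    qed
    have card: "card (\<tau> ` verts G) + 1 = card ?C"
      using c(1) card_Suc_Diff1[of ?C c] by (simp add: img)
    have "proper_colouring G \<tau>"
      unfolding proper_colouring_def
    proof (intro ballI impI)
      fix u v assume uv: "u \<in> verts G" "v \<in> verts G" "u \<rightarrow>\<^bsub>G\<^esub> v"
      \<comment> \<open>At most one end of an edge is recoloured. Its new colour is missing from its
        closed neighbourhood under \<open>\<sigma>\<close>, hence differs from the colour at the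
        other end.\<close>
      have "\<sigma> u \<noteq> \<sigma> v" using less.prems uv by (auto simp: proper_colouring_def)
      moreover have "\<sigma> v \<in> ?S u" "\<sigma> u \<in> ?S v"
        using uv adj_sym by (auto simp: closed_neighbourhood_def)
      ultimately show "\<tau> u \<noteq> \<tau> v"
        using r[of u] r[of v] uv by (auto simp: \<tau>_def)
    qed
    then obtain W where W: "W \<subseteq> verts G"
        "card W + chromatic_number G \<le> card (\<tau> ` verts G) + 1"
        "\<tau> ` (\<Union>w\<in>W. closed_neighbourhood G w) = \<tau> ` verts G"
      using less.hyps[of \<tau>] card by auto
    let ?N = "\<Union>w\<in>W. closed_neighbourhood G w"
    \<comment> \<open>Since \<open>\<tau>\<close> uses one colour fewer than
      \<open>\<sigma>\<close>, the bound leaves room for one extra vertex \<open>x\<close>.\<close>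
    have "\<exists>x\<in>verts G. ?C \<subseteq> \<sigma> ` ?N \<union> ?S x"
    proof (cases "c \<in> \<sigma> ` ?N")
      case True
      \<comment> \<open>A vertex of \<open>?N\<close> with \<open>\<tau>\<close>-colour
        \<open>d\<close> either has this colour under \<open>\<sigma>\<close> too, or was
        recoloured, and then \<open>d\<close> comes from \<open>?S w\<close>.\<close>
      have "d \<in> \<sigma> ` ?N \<union> ?S w" if d: "d \<in> ?C - {c}" for d
      proof -
        obtain y where y: "y \<in> ?N" "\<tau> y = d"
          using d W(3) img by (metis imageE)
        have "y \<in> verts G" using y(1) W(1) closed_neighbourhood_subset by blast
        then show ?thesis using y r[of y] by (auto simp: \<tau>_def split: if_splits)
      qed
      then show ?thesis using w True by blast
    next
      case False
      \<comment> \<open>No vertex of \<open>?N\<close> was recoloured, so only \<open>c\<close>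
        remains to be seen.\<close>
      then have "\<tau> ` ?N = \<sigma> ` ?N" by (intro image_cong) (auto simp: \<tau>_def)
      then have "?C - {c} \<subseteq> \<sigma> ` ?N" using W(3) img by simp
      moreover obtain x where "x \<in> verts G" "\<sigma> x = c" using c(1) by blast
      moreover from this have "c \<in> ?S x" by (auto simp: closed_neighbourhood_def)
      ultimately show ?thesis by (intro bexI[of _ x] subsetI) auto
    qed
    then obtain x where x: "x \<in> verts G" "?C \<subseteq> \<sigma> ` ?N \<union> ?S x" by blast
    have W': "insert x W \<subseteq> verts G" using x(1) W(1) by simp
    have "card (insert x W) \<le> card W + 1"
      using finite_subset[OF W(1) finite_verts] by (simp add: card_insert_if)
    then have "card (insert x W) + chromatic_number G \<le> card ?C + 1"
      using W(2) card by linarith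
    moreover have "\<sigma> ` (\<Union>w\<in>insert x W. closed_neighbourhood G w) = ?C"
    proof
      show "\<sigma> ` (\<Union>w\<in>insert x W. closed_neighbourhood G w) \<subseteq> ?C"
        using W' closed_neighbourhood_subset by (intro image_mono UN_least) blast
      show "?C \<subseteq> \<sigma> ` (\<Union>w\<in>insert x W. closed_neighbourhood G w)"
        using x(2) by (simp add: image_Un Un_commute)
    qed
    ultimately show ?thesis using W' by blast
  qed
qed

lemma chromatic_number_Union_closed_neighbourhoods:
  assumes loc: "locally_colourable s G" and W: "W \<subseteq> verts G"
  shows "chromatic_number (G \<restriction> (\<Union>w\<in>W. closed_neighbourhood G w)) \<le> (s - 1) * card W + 1"
proof -
  let ?X = "\<Union>w\<in>W. closed_neighbourhood G w"
  have finW: "finite W" using W finite_verts by (rule finite_subset)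
  have finX: "finite ?X"
    using finW W finite_subset[OF closed_neighbourhood_subset finite_verts] by auto
  have "\<exists>\<tau>. \<tau> \<in> closed_neighbourhood G w \<rightarrow> {..<s} \<and>
      proper_colouring (G \<restriction> closed_neighbourhood G w) \<tau>" if "w \<in> W" for w
  proof -
    let ?H = "G \<restriction> closed_neighbourhood G w"
    have w: "w \<in> verts G" using that W by blast
    have "colourable ?H (chromatic_number ?H)"
      by (rule colourable_chromatic_number)
        (simp_all add: adj_induce_subgraph_iff not_adj_self
          finite_subset[OF closed_neighbourhood_subset[OF w] finite_verts])
    moreover have "chromatic_number ?H \<le> s" using loc w by (auto simp: locally_colourable_def)
    ultimately show ?thesis 
      by (auto simp: colourable_def Pi_iff intro: less_le_trans)
  qed
  then obtain \<tau> where \<tau>: "\<And>w. w \<in> W \<Longrightarrow> \<tau> w \<in> closed_neighbourhood G w \<rightarrow> {..<s}"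
      "\<And>w. w \<in> W \<Longrightarrow> proper_colouring (G \<restriction> closed_neighbourhood G w) (\<tau> w)"
    by metis
  have \<tau>_neq: "\<tau> w u \<noteq> \<tau> w v"
    if "w \<in> W" "u \<rightarrow>\<^bsub>G\<^esub> v" "u \<in> closed_neighbourhood G w" "v \<in> closed_neighbourhood G w" for w u v
    using \<tau>(2)[OF that(1)] that by (auto simp: proper_colouring_def adj_induce_subgraph_iff)
  define n where "n x = (SOME w. w \<in> W \<and> w \<rightarrow>\<^bsub>G\<^esub> x)" for x
  have n: "n x \<in> W \<and> n x \<rightarrow>\<^bsub>G\<^esub> x" if "\<exists>w\<in>W. w \<rightarrow>\<^bsub>G\<^esub> x" for x
    unfolding n_def by (rule someI_ex) (use that in blast)
  have n_nbh: "x \<in> closed_neighbourhood G (n x)" "n x \<in> closed_neighbourhood G (n x)"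
    if "\<exists>w\<in>W. w \<rightarrow>\<^bsub>G\<^esub> x" for x
    using n[OF that] by (auto simp: closed_neighbourhood_def)
  \<comment> \<open>Tagging the local colour with the chosen neighbour \<open>n x\<close> keeps the
    palettes of different neighbourhoods disjoint; vertices without a neighbour in \<open>W\<close>
    share \<open>None\<close>.\<close>
  define f where "f x = (if \<exists>w\<in>W. w \<rightarrow>\<^bsub>G\<^esub> x then Some (n x, \<tau> (n x) x) else None)" for x
  let ?D = "SIGMA w:W. {..<s} - {\<tau> w w}"
  have range: "f ` ?X \<subseteq> insert None (Some ` ?D)"
  proof -
    have "(n x, \<tau> (n x) x) \<in> ?D" if "\<exists>w\<in>W. w \<rightarrow>\<^bsub>G\<^esub> x" for x
      \<comment> \<open>The vertex \<open>x\<close> is adjacent to \<open>n x\<close>, so its local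
        colour is not that of the centre.\<close>
      using n[OF that] n_nbh[OF that] \<tau>(1)[of "n x"] \<tau>_neq[of "n x" "n x" x] by fastforce
    then show ?thesis by (auto simp: f_def)
  qed
  have "chromatic_number (G \<restriction> ?X) \<le> card (f ` verts (G \<restriction> ?X))"
  proof (rule chromatic_number_le_card_image)
    show "finite (f ` verts (G \<restriction> ?X))" using finX by simp
    fix u v assume "u \<in> verts (G \<restriction> ?X)" "v \<in> verts (G \<restriction> ?X)" "u \<rightarrow>\<^bsub>G \<restriction> ?X\<^esub> v"
    then have uv: "u \<in> ?X" "v \<in> ?X" "u \<rightarrow>\<^bsub>G\<^esub> v" by (auto simp: adj_induce_subgraph_iff)
    show "f u \<noteq> f v"
    proof
      assume eq: "f u = f v"
      show False
      proof (cases "\<exists>w\<in>W. w \<rightarrow>\<^bsub>G\<^esub> u")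
        case True
        then have v: "\<exists>w\<in>W. w \<rightarrow>\<^bsub>G\<^esub> v" using eq by (auto simp: f_def split: if_splits)
        then have "n u = n v" "\<tau> (n v) u = \<tau> (n v) v" using eq True by (auto simp: f_def)
        then show False
          using \<tau>_neq[of "n v" u v] uv(3) n[OF v] n_nbh[OF True] n_nbh[OF v] by auto
      next
        case False
        \<comment> \<open>A vertex of \<open>?X\<close> in no open neighbourhood is itself a centre,
          so its neighbour \<open>v\<close> cannot have colour \<open>None\<close>.\<close>
        then have "u \<in> W" using uv(1) by (auto simp: closed_neighbourhood_def)
        then have "f v \<noteq> None" using uv(3) by (auto simp: f_def)
        then show False using eq False by (simp add: f_def)
      qed
    qed
  qed
  also have "\<dots> \<le> card (insert None (Some ` ?D))"
    using range finW by (intro card_mono) (auto intro!: finite_SigmaI)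
  also have "\<dots> = card ?D + 1"
    using finW by (subst card_insert_disjoint) (auto simp: card_image)
  also have "card ?D = (\<Sum>w\<in>W. s - 1)"
  proof -
    have "card ({..<s} - {\<tau> w w}) = s - 1" if "w \<in> W" for w
      \<comment> \<open>The centre lies in its own closed neighbourhood, so
        \<open>\<tau> w w\<close> is one of the \<open>s\<close> colours and its removal saves
        exactly one.\<close>
      using \<tau>(1)[OF that] by (subst card_Diff_singleton) (auto simp: closed_neighbourhood_def)
    then show ?thesis using finW by (subst card_SigmaI) auto
  qed
  finally show ?thesis by (simp add: mult.commute)
qed

end

theorem theorem3p2:
  fixes G :: "('a, 'b) pre_digraph" and s k :: nat
  assumes "graph G"
    and "verts G \<noteq> {}"
    and "s \<ge> 2"
    and "locally_colourable s G"
    and "chromatic_number G + k \<le> card (verts G)"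
  shows "f_col G (chromatic_number G + k) \<le> (s - 1) * (k + 1) + 1"
proof -
  interpret graph G by fact
  let ?p = "chromatic_number G + k"
  let ?m = "\<lambda>\<sigma>. Min ((\<lambda>X. chromatic_number (G \<restriction> X)) ` {X. X \<subseteq> verts G \<and> card (\<sigma> ` X) = ?p})"
  have fin: "finite (exact_colourings G ?p)"
    by (rule finite_subset[OF _ finite_PiE[of "verts G" "\<lambda>_. {..<?p}"]])
      (auto simp: exact_colourings_def)
  have "?m \<sigma> \<le> (s - 1) * (k + 1) + 1" if "\<sigma> \<in> exact_colourings G ?p" for \<sigma>
  proof -
    have \<sigma>: "proper_colouring G \<sigma>" "card (\<sigma> ` verts G) = ?p"
      using that by (auto simp: exact_colourings_def)
    obtain W where W: "W \<subseteq> verts G" "card W + chromatic_number G \<le> ?p + 1"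
        "\<sigma> ` (\<Union>w\<in>W. closed_neighbourhood G w) = \<sigma> ` verts G"
      using ex_neighbourhoods_see_all_colours[OF \<sigma>(1) assms(2)] \<sigma>(2) by auto
    let ?X = "\<Union>w\<in>W. closed_neighbourhood G w"
    have "?X \<subseteq> verts G" using W(1) closed_neighbourhood_subset by blast
    moreover have "card (\<sigma> ` ?X) = ?p" using W(3) \<sigma>(2) by simp
    ultimately have "?m \<sigma> \<le> chromatic_number (G \<restriction> ?X)"
      by (intro Min_le) auto
    also have "\<dots> \<le> (s - 1) * card W + 1"
      by (rule chromatic_number_Union_closed_neighbourhoods[OF assms(4) W(1)])
    \<comment> \<open>Cancelling \<open>chromatic_number G\<close> in \<open>W(2)\<close> leaves at
      most \<open>k + 1\<close> centres.\<close>
    also have "\<dots> \<le> (s - 1) * (k + 1) + 1"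
      using W(2) by (intro add_right_mono mult_left_mono) auto
    finally show ?thesis .
  qed
  then show ?thesis
    using fin exact_colourings_nonempty[OF assms(5)]
    unfolding f_col_def by (subst Max_le_iff) auto
qed

end
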